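(* For each positive integer $n$, the subset $$I_n := \{ f\in \mathcal{A} \mid \omega(f)\geqslant n\}\cup \{0\}$$ is an ideal of $\mathcal{A}$, and $I_1\supseteq I_2\supseteq I_3\supseteq \cdots$ is an infinite descending chain of ideals. Therefore, the ring $\mathcal{A}$ is not Artinian.
   Context: $\mathds{N}$ denotes the non-negative integers and $\mathds{N}^+=\mathds{N}\setminus\{0\}$. $\mathcal{A}$ is the ring of arithmetical functions: the set of all functions $f\colon \mathds{N}^+\to\mathds{C}$ with pointwise addition $(f+g)(n)=f(n)+g(n)$ and Dirichlet convolution $(f*g)(n)=\sum_{ij=n}f(i)g(j)$ as multiplication. It is a commutative ring with identity $e$, where $e(1)=1$ and $e(n)=0$ for $n>1$. The map $\omega\colon\mathcal{A}\to\mathds{Z}$ is defined by $\omega(0)=0$ and, for $f\neq 0$, $\omega(f)=$ the least positive integer $n$ with $f(n)\neq 0$. *)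

theory Defs
  imports Complex_Main "HOL-Library.FuncSet" "HOL-Algebra.Ideal"
begin

text \<open>
  Functions on the positive integers are represented as extensional functions on \<open>{0<..}\<close>,
  so that equality in the carrier is equality on the positive integers.
\<close>
definition arith_ring :: "(nat \<Rightarrow> complex) ring" where
  "arith_ring =
    \<lparr>carrier = ({0<..} \<rightarrow>\<^sub>E UNIV),
     mult = (\<lambda>f g. \<lambda>n\<in>{0<..}. \<Sum>(i, j)\<in>{(i, j). 0 < i \<and> 0 < j \<and> i * j = n}. f i * g j),
     one = (\<lambda>n\<in>{0<..}. if n = 1 then 1 else 0),
     zero = (\<lambda>n\<in>{0<..}. 0),
     add = (\<lambda>f g. \<lambda>n\<in>{0<..}. f n + g n)\<rparr>"

definition arith_omega :: "(nat \<Rightarrow> complex) \<Rightarrow> int" where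
  "arith_omega f =
    (if f = \<zero>\<^bsub>arith_ring\<^esub> then 0 else int (LEAST n. 0 < n \<and> f n \<noteq> 0))"

definition arith_ideal :: "nat \<Rightarrow> (nat \<Rightarrow> complex) set" where
  "arith_ideal n =
    {f \<in> carrier arith_ring. arith_omega f \<ge> int n} \<union> {\<zero>\<^bsub>arith_ring\<^esub>}"

text \<open>
  The descending chain condition on ideals, intended for commutative rings only (library
  ideals are two-sided). Being a ring is not part of the predicate, because
  otherwise \<open>\<not> artinian R\<close> would hold vacuously for structures that are not rings.
\<close>
definition artinian :: "('a, 'b) ring_scheme \<Rightarrow> bool" where
  "artinian R \<longleftrightarrow>
    (\<forall>I :: nat \<Rightarrow> 'a set. (\<forall>k. ideal (I k) R) \<and> (\<forall>k. I (Suc k) \<subseteq> I k)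
      \<longrightarrow> (\<exists>N. \<forall>k\<ge>N. I k = I N))"

end

theory Submission
  imports Defs
begin

text \<open>
  A nonzero \<open>f\<close> has \<open>\<omega>(f) \<ge> n\<close> exactly when \<open>f\<close> vanishes at every positive integer below \<open>n\<close>,
  and in this form zero is no exception (\<open>arith_ideal_iff\<close>).  Vanishing below \<open>n\<close> is
  preserved by pointwise sums.  It is preserved by convolution with an arbitrary function because
  in a factorisation \<open>i * j = k\<close> with \<open>k < n\<close> the factor \<open>j\<close> is again below \<open>n\<close>, so that every
  term of \<open>(g * f)(k)\<close> contains a vanishing value of \<open>f\<close>.  The chain is strict because the
  indicator function of \<open>{n}\<close> lies in \<open>I\<^sub>n\<close> but not in \<open>I\<close> at \<open>n + 1\<close>, and an infinite strictly
  descending chain of ideals contradicts the descending chain condition.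

  An ideal is an ideal of a ring, so the ring axioms for Dirichlet convolution are needed too.
  The substantial one is associativity (\<open>dirichlet_assoc\<close>): both bracketings are sums over
  the factorisations of \<open>n\<close> into three factors.
\<close>

section \<open>Sums over factorisations\<close>

definition factor_pairs :: "nat \<Rightarrow> (nat \<times> nat) set" where
  "factor_pairs n = {(i, j). 0 < i \<and> 0 < j \<and> i * j = n}"

lemma factor_pairs_iff [simp]:
  "(i, j) \<in> factor_pairs n \<longleftrightarrow> 0 < i \<and> 0 < j \<and> i * j = n"
  by (simp add: factor_pairs_def)

lemma finite_factor_pairs [simp]: "finite (factor_pairs n)"
proof (rule finite_subset)
  show "factor_pairs n \<subseteq> {..n} \<times> {..n}"
    by (auto simp: factor_pairs_def)
qed simp

definition dirichlet :: "(nat \<Rightarrow> 'a) \<Rightarrow> (nat \<Rightarrow> 'a) \<Rightarrow> nat \<Rightarrow> 'a::comm_semiring_1" where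
  "dirichlet f g n = (\<Sum>(i, j)\<in>factor_pairs n. f i * g j)"

lemma dirichlet_cong:
  assumes "\<And>i. 0 < i \<Longrightarrow> f i = f' i" and "\<And>i. 0 < i \<Longrightarrow> g i = g' i"
  shows "dirichlet f g n = dirichlet f' g' n"
  unfolding dirichlet_def by (rule sum.cong) (auto simp: assms)

lemma dirichlet_commute: "dirichlet f g n = dirichlet g f n"
  unfolding dirichlet_def
  by (rule sum.reindex_bij_witness[where i = prod.swap and j = prod.swap])
     (auto simp: mult.commute)

text \<open>
  The bijection sends \<open>((m, k), (i, j))\<close> with \<open>m * k = n\<close> and \<open>i * j = m\<close> to
  \<open>((i, j * k), (j, k))\<close>: both encode the factorisation \<open>i * j * k = n\<close>.
\<close>
lemma dirichlet_assoc: "dirichlet (dirichlet f g) h n = dirichlet f (dirichlet g h) n"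
proof -
  have "dirichlet (dirichlet f g) h n =
      (\<Sum>(p, q)\<in>Sigma (factor_pairs n) (\<lambda>p. factor_pairs (fst p)).
        f (fst q) * g (snd q) * h (snd p))"
    unfolding dirichlet_def
    by (subst sum.Sigma[symmetric]) (auto simp: sum_distrib_right case_prod_beta)
  also have "\<dots> =
      (\<Sum>(p, q)\<in>Sigma (factor_pairs n) (\<lambda>p. factor_pairs (snd p)).
        f (fst p) * (g (fst q) * h (snd q)))"
    by (rule sum.reindex_bij_witness
        [where i = "\<lambda>((i, _), (j, k)). ((i * j, k), (i, j))"
           and j = "\<lambda>((_, k), (i, j)). ((i, j * k), (j, k))"])
       (auto simp: mult.assoc)
  also have "\<dots> = dirichlet f (dirichlet g h) n"
    unfolding dirichlet_def
    by (subst sum.Sigma[symmetric]) (auto simp: sum_distrib_left case_prod_beta)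
  finally show ?thesis .
qed

lemma dirichlet_one_left:
  assumes "0 < n"
  shows "dirichlet (\<lambda>i. if i = 1 then 1 else 0) f n = f n"
proof -
  have "dirichlet (\<lambda>i. if i = 1 then 1 else 0) f n =
      (\<Sum>(i, j)\<in>{(1::nat, n)}. (if i = 1 then 1 else 0) * f j)"
    unfolding dirichlet_def
    by (rule sum.mono_neutral_right) (use assms in \<open>auto split: if_splits\<close>)
  then show ?thesis by simp
qed

lemma dirichlet_add_left:
  "dirichlet (\<lambda>i. f i + g i) h n = dirichlet f h n + dirichlet g h n"
  by (simp add: dirichlet_def case_prod_beta distrib_right sum.distrib)

lemma dirichlet_vanish_below:
  assumes vanish: "\<And>k. 0 < k \<Longrightarrow> k < n \<Longrightarrow> f k = 0" and "k < n"
  shows "dirichlet g f k = 0"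
  unfolding dirichlet_def
proof (rule sum.neutral, clarify)
  fix i j
  assume "(i, j) \<in> factor_pairs k"
  then have "0 < i" "0 < j" "i * j = k" by auto
  then have "j \<le> k" by auto
  with \<open>k < n\<close> \<open>0 < j\<close> show "g i * f j = 0" by (simp add: vanish)
qed

section \<open>The ring of arithmetical functions\<close>

lemma carrier_arith_ring: "carrier arith_ring = {0<..} \<rightarrow>\<^sub>E UNIV"
  by (simp add: arith_ring_def)

lemma mult_arith_ring: "f \<otimes>\<^bsub>arith_ring\<^esub> g = (\<lambda>n\<in>{0<..}. dirichlet f g n)"
  by (simp add: arith_ring_def dirichlet_def factor_pairs_def)

lemma add_arith_ring: "f \<oplus>\<^bsub>arith_ring\<^esub> g = (\<lambda>n\<in>{0<..}. f n + g n)"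
  by (simp add: arith_ring_def)

lemma one_arith_ring: "\<one>\<^bsub>arith_ring\<^esub> = (\<lambda>n\<in>{0<..}. if n = 1 then 1 else 0)"
  by (simp add: arith_ring_def)

lemma zero_arith_ring: "\<zero>\<^bsub>arith_ring\<^esub> = (\<lambda>n\<in>{0<..}. 0)"
  by (simp add: arith_ring_def)

lemmas arith_ring_simps =
  carrier_arith_ring mult_arith_ring add_arith_ring one_arith_ring zero_arith_ring

lemma arith_fun_eqI:
  assumes "f \<in> carrier arith_ring" and "g \<in> carrier arith_ring"
    and "\<And>n. 0 < n \<Longrightarrow> f n = g n"
  shows "f = g"
  using assms unfolding carrier_arith_ring by (metis PiE_ext greaterThan_iff)

lemma
  shows uminus_arith_fun_closed: "(\<lambda>n\<in>{0<..}. - f n) \<in> carrier arith_ring"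
    and add_uminus_arith_fun: "(\<lambda>n\<in>{0<..}. - f n) \<oplus>\<^bsub>arith_ring\<^esub> f = \<zero>\<^bsub>arith_ring\<^esub>"
proof -
  show "(\<lambda>n\<in>{0<..}. - f n) \<in> carrier arith_ring"
    by (simp add: carrier_arith_ring)
  show "(\<lambda>n\<in>{0<..}. - f n) \<oplus>\<^bsub>arith_ring\<^esub> f = \<zero>\<^bsub>arith_ring\<^esub>"
    by (rule arith_fun_eqI) (auto simp: arith_ring_simps)
qed

lemma abelian_group_arith_ring: "abelian_group arith_ring"
proof (rule abelian_groupI)
  fix f
  show "\<exists>g\<in>carrier arith_ring. g \<oplus>\<^bsub>arith_ring\<^esub> f = \<zero>\<^bsub>arith_ring\<^esub>"
    using uminus_arith_fun_closed add_uminus_arith_fun by blast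
next
  fix f
  assume "f \<in> carrier arith_ring"
  then show "\<zero>\<^bsub>arith_ring\<^esub> \<oplus>\<^bsub>arith_ring\<^esub> f = f"
    by (intro arith_fun_eqI) (auto simp: arith_ring_simps)
next
  fix f g
  show "f \<oplus>\<^bsub>arith_ring\<^esub> g = g \<oplus>\<^bsub>arith_ring\<^esub> f"
    by (rule arith_fun_eqI) (auto simp: arith_ring_simps)
next
  fix f g h
  show "f \<oplus>\<^bsub>arith_ring\<^esub> g \<oplus>\<^bsub>arith_ring\<^esub> h = f \<oplus>\<^bsub>arith_ring\<^esub> (g \<oplus>\<^bsub>arith_ring\<^esub> h)"
    by (rule arith_fun_eqI) (auto simp: arith_ring_simps)
qed (auto simp: arith_ring_simps)

lemma comm_monoid_arith_ring: "comm_monoid arith_ring"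
proof (rule comm_monoidI)
  fix f g h
  show "f \<otimes>\<^bsub>arith_ring\<^esub> g \<otimes>\<^bsub>arith_ring\<^esub> h = f \<otimes>\<^bsub>arith_ring\<^esub> (g \<otimes>\<^bsub>arith_ring\<^esub> h)"
  proof (rule arith_fun_eqI)
    fix n :: nat
    assume "0 < n"
    have "dirichlet (\<lambda>n\<in>{0<..}. dirichlet f g n) h n = dirichlet (dirichlet f g) h n"
      by (rule dirichlet_cong) auto
    also have "\<dots> = dirichlet f (dirichlet g h) n"
      by (rule dirichlet_assoc)
    also have "\<dots> = dirichlet f (\<lambda>n\<in>{0<..}. dirichlet g h n) n"
      by (rule dirichlet_cong) auto
    finally show "(f \<otimes>\<^bsub>arith_ring\<^esub> g \<otimes>\<^bsub>arith_ring\<^esub> h) n =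
        (f \<otimes>\<^bsub>arith_ring\<^esub> (g \<otimes>\<^bsub>arith_ring\<^esub> h)) n"
      using \<open>0 < n\<close> by (simp add: mult_arith_ring)
  qed (auto simp: arith_ring_simps)
next
  fix f
  assume f: "f \<in> carrier arith_ring"
  show "\<one>\<^bsub>arith_ring\<^esub> \<otimes>\<^bsub>arith_ring\<^esub> f = f"
  proof (rule arith_fun_eqI)
    fix n :: nat
    assume "0 < n"
    have "dirichlet \<one>\<^bsub>arith_ring\<^esub> f n = dirichlet (\<lambda>i. if i = 1 then 1 else 0) f n"
      by (rule dirichlet_cong) (auto simp: one_arith_ring)
    then show "(\<one>\<^bsub>arith_ring\<^esub> \<otimes>\<^bsub>arith_ring\<^esub> f) n = f n"
      using \<open>0 < n\<close> by (simp only: mult_arith_ring dirichlet_one_left) simp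
  qed (use f in \<open>auto simp: arith_ring_simps\<close>)
next
  fix f g
  show "f \<otimes>\<^bsub>arith_ring\<^esub> g = g \<otimes>\<^bsub>arith_ring\<^esub> f"
    by (simp only: mult_arith_ring dirichlet_commute[of f])
qed (auto simp: arith_ring_simps)

lemma cring_arith_ring: "cring arith_ring"
proof (rule cringI[OF abelian_group_arith_ring comm_monoid_arith_ring])
  fix f g h
  show "(f \<oplus>\<^bsub>arith_ring\<^esub> g) \<otimes>\<^bsub>arith_ring\<^esub> h =
      f \<otimes>\<^bsub>arith_ring\<^esub> h \<oplus>\<^bsub>arith_ring\<^esub> g \<otimes>\<^bsub>arith_ring\<^esub> h"
  proof (rule arith_fun_eqI)
    fix n :: nat
    assume "0 < n"
    have "dirichlet (\<lambda>n\<in>{0<..}. f n + g n) h n = dirichlet (\<lambda>n. f n + g n) h n"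
      by (rule dirichlet_cong) auto
    then show "((f \<oplus>\<^bsub>arith_ring\<^esub> g) \<otimes>\<^bsub>arith_ring\<^esub> h) n =
        (f \<otimes>\<^bsub>arith_ring\<^esub> h \<oplus>\<^bsub>arith_ring\<^esub> g \<otimes>\<^bsub>arith_ring\<^esub> h) n"
      using \<open>0 < n\<close> by (simp add: mult_arith_ring add_arith_ring dirichlet_add_left)
  qed (auto simp: arith_ring_simps)
qed

lemma minus_arith_ring:
  assumes "f \<in> carrier arith_ring"
  shows "\<ominus>\<^bsub>arith_ring\<^esub> f = (\<lambda>n\<in>{0<..}. - f n)"
  by (rule abelian_group.minus_equality[OF abelian_group_arith_ring add_uminus_arith_fun
        assms uminus_arith_fun_closed])

section \<open>The ideals of functions vanishing below a bound\<close>

text \<open>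
  This form of membership removes the case distinction for zero, whose \<open>\<omega>\<close> is \<open>0\<close>
  by convention although zero vanishes below every bound.
\<close>
lemma arith_ideal_iff:
  "f \<in> arith_ideal n \<longleftrightarrow> f \<in> carrier arith_ring \<and> (\<forall>k. 0 < k \<longrightarrow> k < n \<longrightarrow> f k = 0)"
proof (cases "f = \<zero>\<^bsub>arith_ring\<^esub>")
  case True
  then show ?thesis
    by (auto simp: arith_ideal_def arith_ring_simps)
next
  case False
  show ?thesis
  proof (cases "f \<in> carrier arith_ring")
    case f: True
    define m where "m = (LEAST k. 0 < k \<and> f k \<noteq> 0)"
    have "\<exists>k. 0 < k \<and> f k \<noteq> 0"
      using False arith_fun_eqI[OF f, of "\<zero>\<^bsub>arith_ring\<^esub>"] by (auto simp: arith_ring_simps)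
    then have m: "0 < m \<and> f m \<noteq> 0"
      unfolding m_def by (rule LeastI_ex)
    have least: "m \<le> k" if "0 < k" "f k \<noteq> 0" for k
      unfolding m_def by (rule Least_le) (use that in simp)
    have "f \<in> arith_ideal n \<longleftrightarrow> n \<le> m"
      using f False by (simp add: arith_ideal_def arith_omega_def m_def)
    also have "\<dots> \<longleftrightarrow> (\<forall>k. 0 < k \<longrightarrow> k < n \<longrightarrow> f k = 0)"
      using m least by (meson leD leI less_le_trans)
    finally show ?thesis using f by simp
  qed (use False in \<open>simp add: arith_ideal_def\<close>)
qed

lemma ideal_arith_ideal: "ideal (arith_ideal n) arith_ring"
proof -
  interpret cring arith_ring by (rule cring_arith_ring)
  have absorb: "g \<otimes>\<^bsub>arith_ring\<^esub> f \<in> arith_ideal n" if "f \<in> arith_ideal n" for f g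
    using that dirichlet_vanish_below[of n f]
    by (auto simp: arith_ideal_iff arith_ring_simps)
  show ?thesis
  proof (rule idealI)
    show "subgroup (arith_ideal n) (add_monoid arith_ring)"
    proof (rule add.subgroupI)
      have "\<zero>\<^bsub>arith_ring\<^esub> \<in> arith_ideal n" by (simp add: arith_ideal_def)
      then show "arith_ideal n \<noteq> {}" by blast
    next
      fix f
      assume "f \<in> arith_ideal n"
      then show "\<ominus>\<^bsub>arith_ring\<^esub> f \<in> arith_ideal n"
        by (auto simp: arith_ideal_iff minus_arith_ring) (auto simp: carrier_arith_ring)
    qed (auto simp: arith_ideal_iff arith_ring_simps)
  next
    fix f g
    assume "f \<in> arith_ideal n" and "g \<in> carrier arith_ring"
    then show "f \<otimes>\<^bsub>arith_ring\<^esub> g \<in> arith_ideal n"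
      using absorb m_comm by (metis arith_ideal_iff)
  qed (auto intro: absorb ring_axioms)
qed

lemma arith_ideal_strict_descending:
  assumes "1 \<le> n"
  shows "arith_ideal (Suc n) \<subset> arith_ideal n"
proof
  show "arith_ideal (Suc n) \<subseteq> arith_ideal n"
    by (auto simp: arith_ideal_iff)
  define d :: "nat \<Rightarrow> complex" where "d = (\<lambda>k\<in>{0<..}. if k = n then 1 else 0)"
  have "d \<in> arith_ideal n" and "d \<notin> arith_ideal (Suc n)"
    using assms by (auto simp: d_def arith_ideal_iff carrier_arith_ring)
  then show "arith_ideal (Suc n) \<noteq> arith_ideal n" by blast
qed

lemma not_artinianI:
  assumes "\<And>k. ideal (I k) R" and "\<And>k. I (Suc k) \<subset> I k"
  shows "\<not> artinian R"
proof
  have chain: "(\<forall>k. ideal (I k) R) \<and> (\<forall>k. I (Suc k) \<subseteq> I k)"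
    by (intro conjI allI psubset_imp_subset assms)
  assume "artinian R"
  then obtain N where "\<forall>k\<ge>N. I k = I N"
    unfolding artinian_def using chain by blast
  then have "I (Suc N) = I N" by (meson le_SucI le_refl)
  with assms(2)[of N] show False by simp
qed

theorem theorem2p8:
  shows "(\<forall>n\<ge>1. ideal (arith_ideal n) arith_ring) \<and>
         (\<forall>n\<ge>1. arith_ideal (Suc n) \<subset> arith_ideal n) \<and>
         \<not> artinian arith_ring"
proof (intro conjI allI impI)
  \<comment> \<open>The inclusion at \<open>n = 0\<close> is not strict, so the chain starts at \<open>I\<^sub>1\<close>.\<close>
  show "\<not> artinian arith_ring"
    by (rule not_artinianI[where I = "\<lambda>k. arith_ideal (Suc k)"])
       (simp_all add: ideal_arith_ideal arith_ideal_strict_descending)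
qed (simp_all add: ideal_arith_ideal arith_ideal_strict_descending)

end
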